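(* Let $X_m(t)=\mathcal{V}_mG_m(t)\mathcal{W}_m^T$ be the approximate solution obtained at step $m$ of the block (or extended block) Arnoldi method. Then, for $t\in[t_0,T_f]$, $$\dot X_m(t)=(A-F_{m,A})\,X_m(t)+X_m(t)\,(B-F_{m,B})+EF^T,$$ where $F_{m,A}=V_{m+1}\,T_{m+1,m}^A\,V_m^T$ and $F_{m,B}=W_m\,(T_{m+1,m}^B)^T\,W_{m+1}^T$.
   Context: Let $A\in\mathbb{R}^{n\times n}$ and $B\in\mathbb{R}^{p\times p}$ be constant matrices, and let $E\in\mathbb{R}^{n\times s}$, $F\in\mathbb{R}^{p\times s}$ be constant full rank matrices. Let $t_0<T_f$ be real numbers and $m\ge 1$ an integer. Krylov subspaces. Two cases are treated simultaneously. In the block Krylov case put $d=s$, $\mathcal{K}_j(A,E)=\mathrm{range}(E,AE,\ldots,A^{j-1}E)$ and $\mathcal{K}_j(B^T,F)=\mathrm{range}(F,B^TF,\ldots,(B^T)^{j-1}F)$. In the extended block Krylov case ($A$, $B$ nonsingular) put $d=2s$, $\mathcal{K}_j(A,E)=\mathrm{range}(A^{-j}E,\ldots,A^{-1}E,E,AE,\ldots,A^{j-1}E)$ and likewise $\mathcal{K}_j(B^T,F)$ with $(A,E)$ replaced by $(B^T,F)$. The (extended) block Arnoldi algorithm applied to $(A,E)$ and $(B^T,F)$ is assumed not to break down. It produces blocks $V_1,\ldots,V_{m+1}\in\mathbb{R}^{n\times d}$ and $W_1,\ldots,W_{m+1}\in\mathbb{R}^{p\times d}$ such that, for each $j\le m+1$,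 the columns of $\mathcal{V}_j=[V_1,\ldots,V_j]$ form an orthonormal basis of $\mathcal{K}_j(A,E)$ and the columns of $\mathcal{W}_j=[W_1,\ldots,W_j]$ form an orthonormal basis of $\mathcal{K}_j(B^T,F)$. (Note that $V_m$, $W_m$ denote single blocks, while $\mathcal{V}_m$, $\mathcal{W}_m$ collect all $m$ blocks.) Put $\mathcal{T}_{m,A}=\mathcal{V}_m^TA\mathcal{V}_m$, $\mathcal{T}_{m,B}=\mathcal{W}_m^TB^T\mathcal{W}_m$, $T_{m+1,m}^A=V_{m+1}^TAV_m$, $T_{m+1,m}^B=W_{m+1}^TB^TW_m$ (both $d\times d$), $E_m=\mathcal{V}_m^TE$, $F_m=\mathcal{W}_m^TF$. The $md\times md$ matrix function $G_m$ is $$G_m(t)=\int_{t_0}^{t} e^{(t-\tau)\mathcal{T}_{m,A}}\,E_m\,F_m^T\,e^{(t-\tau)\mathcal{T}_{m,B}^T}\,d\tau,$$ which satisfies $\dot G_m=\mathcal{T}_{m,A}G_m+G_m\mathcal{T}_{m,B}^T+E_mF_m^T$ on $[t_0,T_f]$. *)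

theory Defs
  imports "HOL-Analysis.Analysis" "Jordan_Normal_Form.DL_Rank"
    "Jordan_Normal_Form.Gauss_Jordan_Elimination"
begin

unbundle no vec_syntax
no_notation inner (infix "\<bullet>" 70)
hide_const (open) Finite_Cartesian_Product.vec Finite_Cartesian_Product.mat
  Finite_Cartesian_Product.row Finite_Cartesian_Product.transpose

definition full_rank :: "real mat \<Rightarrow> bool" where
  "full_rank M \<longleftrightarrow> vec_space.rank (dim_row M) M = min (dim_row M) (dim_col M)"

definition col_range :: "real mat \<Rightarrow> real vec set" where
  "col_range M = vec_space.col_space (dim_row M) M"

text \<open>The horizontal concatenation \<open>[M\<^sub>1, \<dots>, M\<^sub>k]\<close> of matrices with \<open>n\<close> rows.\<close>

definition block_row :: "nat \<Rightarrow> real mat list \<Rightarrow> real mat" where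
  "block_row n Ms = mat_of_cols n (concat (map cols Ms))"

text \<open>Meaningful for negative exponents only when \<open>A\<close> is nonsingular.\<close>

definition mat_powi :: "real mat \<Rightarrow> int \<Rightarrow> real mat" where
  "mat_powi A k = (if k \<ge> 0 then A ^\<^sub>m nat k else the (mat_inverse A) ^\<^sub>m nat (- k))"

datatype arnoldi_kind = Block | Extended

fun block_width :: "arnoldi_kind \<Rightarrow> nat \<Rightarrow> nat" where
  "block_width Block s = s"
| "block_width Extended s = 2 * s"

fun krylov :: "arnoldi_kind \<Rightarrow> nat \<Rightarrow> real mat \<Rightarrow> real mat \<Rightarrow> real vec set" where
  "krylov Block j A E = col_range (block_row (dim_row A) (map (\<lambda>i. A ^\<^sub>m i * E) [0..<j]))"
| "krylov Extended j A E =
    col_range (block_row (dim_row A) (map (\<lambda>i. mat_powi A i * E) [- int j..int j - 1]))"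

definition orthonormal_basis_cols :: "real mat \<Rightarrow> real vec set \<Rightarrow> bool" where
  "orthonormal_basis_cols M U \<longleftrightarrow>
    (\<forall>i<dim_col M. \<forall>j<dim_col M. col M i \<bullet> col M j = (if i = j then 1 else 0)) \<and>
    col_range M = U"

text \<open>Blocks are indexed from 1, so \<open>collect_blocks n V j = [V\<^sub>1, \<dots>, V\<^sub>j]\<close>.\<close>

definition collect_blocks :: "nat \<Rightarrow> (nat \<Rightarrow> real mat) \<Rightarrow> nat \<Rightarrow> real mat" where
  "collect_blocks n V j = block_row n (map V [1..<Suc j])"

text \<open>What a run of the (extended) block Arnoldi process on \<open>(A, E)\<close> without breakdown
  delivers: \<open>k\<close> blocks of full width whose leading parts span the nested Krylov spaces.\<close>

definition arnoldi_blocks ::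
    "arnoldi_kind \<Rightarrow> real mat \<Rightarrow> real mat \<Rightarrow> nat \<Rightarrow> (nat \<Rightarrow> real mat) \<Rightarrow> bool" where
  "arnoldi_blocks kind A E k V \<longleftrightarrow>
    (\<forall>j\<in>{1..k}. V j \<in> carrier_mat (dim_row A) (block_width kind (dim_col E)) \<and>
      orthonormal_basis_cols (collect_blocks (dim_row A) V j) (krylov kind j A E))"

text \<open>There is no topology on the type of matrices of variable size, so the exponential series,
  the integral and the derivative are taken entrywise.\<close>

definition mat_exp :: "real mat \<Rightarrow> real mat" where
  "mat_exp M = mat (dim_row M) (dim_row M) (\<lambda>(i, j). \<Sum>k. (M ^\<^sub>m k) $$ (i, j) / fact k)"

definition mat_integral :: "nat \<Rightarrow> nat \<Rightarrow> real set \<Rightarrow> (real \<Rightarrow> real mat) \<Rightarrow> real mat" where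
  "mat_integral nr nc S f = mat nr nc (\<lambda>(i, j). integral S (\<lambda>x. f x $$ (i, j)))"

definition has_mat_derivative_within ::
    "(real \<Rightarrow> real mat) \<Rightarrow> real mat \<Rightarrow> real \<Rightarrow> real set \<Rightarrow> bool" where
  "has_mat_derivative_within f D t S \<longleftrightarrow>
    (\<forall>u\<in>S. f u \<in> carrier_mat (dim_row D) (dim_col D)) \<and>
    (\<forall>i<dim_row D. \<forall>j<dim_col D.
      ((\<lambda>u. f u $$ (i, j)) has_real_derivative D $$ (i, j)) (at t within S))"

end

theory Submission
  imports Defs
begin

text \<open>
  Write \<open>Q = calV\<close>, \<open>S = calW\<close>, and \<open>C = Em * Fm\<^sup>T\<close>. A fact of linear algebra and a fact of
  calculus combine.

  Linear algebra: the product \<open>A * Q\<close> has its columns in the next Krylov space,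
  and only the last block of \<open>Q\<close> can have an image with a component along the new block
  \<open>V (m + 1)\<close>. The matrix \<open>FmA\<close> removes exactly this component, so
  \<open>(A - FmA) * Q = Q * TA\<close> (lemma \<open>arnoldi_relation\<close>): although \<open>A\<close> need not leave
  the Krylov space invariant, \<open>A - FmA\<close> does, and \<open>TA\<close> represents it there. The same relation for
  \<open>B\<^sup>T\<close>, transposed, is \<open>S\<^sup>T * (B - FmB) = TB\<^sup>T * S\<^sup>T\<close>. Since the columns of \<open>E\<close> and
  \<open>F\<close> lie in the Krylov spaces, also \<open>Q * C * S\<^sup>T = E * F\<^sup>T\<close>.

  Calculus: the substitution \<open>\<tau> \<mapsto> t + t0 - \<tau>\<close> moves the dependence on \<open>t\<close> from the
  integrand of \<open>G t\<close> to the limit of integration, so \<open>G\<close> is a primitive of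
  \<open>\<Phi> (t - t0)\<close> with \<open>\<Phi> u = exp(u TA) * C * exp(u TB\<^sup>T)\<close>. As
  \<open>\<Phi>' = TA * \<Phi> + \<Phi> * TB\<^sup>T\<close> and \<open>\<Phi> 0 = C\<close>, integrating \<open>\<Phi>'\<close> gives
  \<open>G' = TA * G + G * TB\<^sup>T + C\<close> (lemma \<open>has_mat_derivative_sylvester_integral\<close>).

  Multiplying this equation by \<open>Q\<close> on the left and by \<open>S\<^sup>T\<close> on the right and moving both factors
  inside with the relations above yields the equation for \<open>X = Q * G * S\<^sup>T\<close>.
\<close>

section \<open>Column ranges and Krylov spaces\<close>

lemma col_range_eq:
  "col_range M = {M *\<^sub>v x | x. x \<in> carrier_vec (dim_col M)}"
proof -
  have M: "M \<in> carrier_mat (dim_row M) (dim_col M)" by simp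
  show ?thesis
    unfolding col_range_def vec_space.col_space_eq[OF M] using mult_mat_vec_carrier[OF M] by blast
qed

lemma col_in_col_range:
  assumes "j < dim_col M"
  shows "col M j \<in> col_range M"
proof -
  have "col M j = M *\<^sub>v unit_vec (dim_col M) j"
    using assms by (intro eq_vecI) simp_all
  thus ?thesis unfolding col_range_eq using unit_vec_carrier by blast
qed

text \<open>Turns a statement about ranges into a matrix equation, which is how membership of columns in
  a Krylov space is used throughout.\<close>

lemma factor_through_col_range:
  assumes N: "N \<in> carrier_mat n q" and M: "M \<in> carrier_mat n r"
    and cols: "\<And>j. j < r \<Longrightarrow> col M j \<in> col_range N"
  obtains Y where "Y \<in> carrier_mat q r" "M = N * Y"
proof -
  from cols have "\<forall>j. \<exists>y. j < r \<longrightarrow> y \<in> carrier_vec q \<and> col M j = N *\<^sub>v y"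
    using N by (auto simp: col_range_eq)
  from choice[OF this] obtain y
    where y: "y j \<in> carrier_vec q" "col M j = N *\<^sub>v y j" if "j < r" for j
    by blast
  define Y where "Y = mat_of_cols q (map y [0..<r])"
  have Y: "Y \<in> carrier_mat q r" by (auto simp: Y_def)
  have col_Y: "col Y j = y j" if "j < r" for j
    using that y by (simp add: Y_def)
  have "M = N * Y"
  proof (rule mat_col_eqI)
    fix j assume "j < dim_col (N * Y)"
    hence j: "j < r" using Y by simp
    show "col M j = col (N * Y) j"
      using y(2)[OF j] col_Y[OF j] Y j by (simp add: col_mult2[OF N Y j])
  qed (use M N Y in auto)
  with Y show ?thesis by (rule that)
qed

lemma col_range_subset_of_cols:
  assumes N: "N \<in> carrier_mat n q" and M: "M \<in> carrier_mat n r"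
    and cols: "\<And>j. j < r \<Longrightarrow> col M j \<in> col_range N"
  shows "col_range M \<subseteq> col_range N"
proof -
  obtain Y where Y: "Y \<in> carrier_mat q r" "M = N * Y"
    using factor_through_col_range[OF N M cols] .
  show ?thesis
  proof
    fix v assume "v \<in> col_range M"
    then obtain x where x: "x \<in> carrier_vec r" "v = M *\<^sub>v x" using M by (auto simp: col_range_eq)
    hence "v = N *\<^sub>v (Y *\<^sub>v x)" "Y *\<^sub>v x \<in> carrier_vec (dim_col N)" using Y N by auto
    thus "v \<in> col_range N" unfolding col_range_eq by blast
  qed
qed

lemma orthonormal_cols_transpose_mult:
  assumes "orthonormal_basis_cols Q U" and Q: "Q \<in> carrier_mat n q"
  shows "transpose_mat Q * Q = 1\<^sub>m q"
  using assms by (intro eq_matI) (auto simp: orthonormal_basis_cols_def)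

text \<open>If \<open>Q\<close> has orthonormal columns, \<open>Q * Q\<^sup>T\<close> is the orthogonal projector onto its range:
  \<open>M = Q * Y\<close> gives \<open>Q * Q\<^sup>T * Q * Y = Q * Y\<close>.\<close>

lemma orthogonal_projector_fixes:
  assumes Q: "Q \<in> carrier_mat n q" and onb: "orthonormal_basis_cols Q U"
    and M: "M \<in> carrier_mat n r" and cols: "\<And>j. j < r \<Longrightarrow> col M j \<in> U"
  shows "Q * transpose_mat Q * M = M"
proof -
  have "U = col_range Q" using onb by (simp add: orthonormal_basis_cols_def)
  with cols have "\<And>j. j < r \<Longrightarrow> col M j \<in> col_range Q" by simp
  then obtain Y where Y: "Y \<in> carrier_mat q r" "M = Q * Y"
    using factor_through_col_range[OF Q M] by auto
  have "Q * transpose_mat Q * M = Q * (transpose_mat Q * (Q * Y))"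
    using Q Y by (simp add: assoc_mult_mat[of _ n q _ n _ r])
  also have "transpose_mat Q * (Q * Y) = transpose_mat Q * Q * Y"
    using Q Y by (simp add: assoc_mult_mat[of _ q n _ q _ r])
  also have "\<dots> = Y"
    using orthonormal_cols_transpose_mult[OF onb Q] Y by simp
  finally show ?thesis using Y by simp
qed

lemma dim_row_block_row [simp]: "dim_row (block_row n Ms) = n"
  by (simp add: block_row_def)

lemma set_cols_eq: "set (cols M) = col M ` {..<dim_col M}"
  by (auto simp: cols_def)

lemma cols_block_row_eq:
  assumes "\<And>M. M \<in> set Ms \<Longrightarrow> dim_row M = n"
  shows "col (block_row n Ms) ` {..<dim_col (block_row n Ms)} =
    (\<Union>M\<in>set Ms. col M ` {..<dim_col M})"
proof -
  have "set (cols M) \<subseteq> carrier_vec n" if "M \<in> set Ms" for M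
    using assms[OF that] cols_dim[of M] by simp
  hence "set (concat (map cols Ms)) \<subseteq> carrier_vec n" by simp blast
  hence "cols (block_row n Ms) = concat (map cols Ms)"
    unfolding block_row_def by (rule cols_mat_of_cols)
  hence "set (cols (block_row n Ms)) = (\<Union>M\<in>set Ms. set (cols M))" by simp
  thus ?thesis unfolding set_cols_eq .
qed

lemma col_block_row_member:
  assumes Ms: "\<And>M. M \<in> set Ms \<Longrightarrow> dim_row M = n" and j: "j < dim_col (block_row n Ms)"
  shows "\<exists>M\<in>set Ms. \<exists>k<dim_col M. col (block_row n Ms) j = col M k"
proof -
  have "col (block_row n Ms) j \<in> col (block_row n Ms) ` {..<dim_col (block_row n Ms)}"
    using j by (intro imageI) simp
  also have "\<dots> = (\<Union>M\<in>set Ms. col M ` {..<dim_col M})"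
    using Ms by (rule cols_block_row_eq)
  finally show ?thesis by blast
qed

lemma block_col_in_col_range:
  assumes Ms: "\<And>M. M \<in> set Ms \<Longrightarrow> dim_row M = n" and M: "M \<in> set Ms" and k: "k < dim_col M"
  shows "col M k \<in> col_range (block_row n Ms)"
proof -
  have "col M k \<in> (\<Union>M\<in>set Ms. col M ` {..<dim_col M})" using M k by blast
  also have "\<dots> = col (block_row n Ms) ` {..<dim_col (block_row n Ms)}"
    using Ms by (rule cols_block_row_eq[symmetric])
  finally have "col M k \<in> col (block_row n Ms) ` {..<dim_col (block_row n Ms)}" .
  then obtain j where j: "j < dim_col (block_row n Ms)" "col M k = col (block_row n Ms) j"
    by blast
  show ?thesis unfolding j(2) using j(1) by (rule col_in_col_range)
qed

text \<open>If left multiplication by \<open>A\<close> sends every block of one list to a block of another, it maps the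
  one range into the other. Both kinds of Krylov space have this shape, with exponents shifted
  by one.\<close>

lemma mult_col_range_block_row:
  assumes A: "A \<in> carrier_mat n n"
    and Ms: "\<And>M. M \<in> set Ms \<Longrightarrow> dim_row M = n"
    and Ns: "\<And>N. N \<in> set Ns \<Longrightarrow> dim_row N = n"
    and shift: "\<And>M. M \<in> set Ms \<Longrightarrow> A * M \<in> set Ns"
    and v: "v \<in> col_range (block_row n Ms)"
  shows "A *\<^sub>v v \<in> col_range (block_row n Ns)"
proof -
  define q where "q = dim_col (block_row n Ms)"
  have M: "block_row n Ms \<in> carrier_mat n q" by (intro carrier_matI) (simp_all add: q_def)
  have AM: "A * block_row n Ms \<in> carrier_mat n q" using A M by (rule mult_carrier_mat)
  have N: "block_row n Ns \<in> carrier_mat n (dim_col (block_row n Ns))" by (intro carrier_matI) simp_all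
  have "col (A * block_row n Ms) j \<in> col_range (block_row n Ns)" if j: "j < q" for j
  proof -
    have "\<exists>M'\<in>set Ms. \<exists>k<dim_col M'. col (block_row n Ms) j = col M' k"
      using Ms j[unfolded q_def] by (rule col_block_row_member)
    then obtain M' k
      where M': "M' \<in> set Ms" "k < dim_col M'" "col (block_row n Ms) j = col M' k"
      by (elim bexE exE conjE)
    have M'c: "M' \<in> carrier_mat n (dim_col M')" using Ms[OF M'(1)] by (intro carrier_matI) simp_all
    have "col (A * block_row n Ms) j = A *\<^sub>v col M' k"
      unfolding col_mult2[OF A M j] M'(3) ..
    also have "\<dots> = col (A * M') k" by (rule col_mult2[OF A M'c M'(2), symmetric])
    also have "\<dots> \<in> col_range (block_row n Ns)"
    proof (rule block_col_in_col_range)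
      show "A * M' \<in> set Ns" using M'(1) by (rule shift)
    qed (use Ns M' in auto)
    finally show ?thesis .
  qed
  with N AM have "col_range (A * block_row n Ms) \<subseteq> col_range (block_row n Ns)"
    by (rule col_range_subset_of_cols)
  moreover have "A *\<^sub>v v \<in> col_range (A * block_row n Ms)"
  proof -
    obtain x where x: "x \<in> carrier_vec q" "v = block_row n Ms *\<^sub>v x"
      using v unfolding col_range_eq q_def by blast
    have "A *\<^sub>v v = (A * block_row n Ms) *\<^sub>v x"
      unfolding x(2) by (rule assoc_mult_mat_vec[OF A M x(1), symmetric])
    moreover have "x \<in> carrier_vec (dim_col (A * block_row n Ms))"
      using x(1) unfolding carrier_matD(2)[OF AM] .
    ultimately show ?thesis unfolding col_range_eq by blast
  qed
  ultimately show ?thesis by (rule subsetD)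
qed

lemma col_range_block_row_mono:
  assumes Ns: "\<And>N. N \<in> set Ns \<Longrightarrow> dim_row N = n" and sub: "set Ms \<subseteq> set Ns"
  shows "col_range (block_row n Ms) \<subseteq> col_range (block_row n Ns)"
proof (rule col_range_subset_of_cols)
  show "block_row n Ms \<in> carrier_mat n (dim_col (block_row n Ms))"
    "block_row n Ns \<in> carrier_mat n (dim_col (block_row n Ns))" by (auto intro!: carrier_matI)
  fix j assume j: "j < dim_col (block_row n Ms)"
  have "dim_row M = n" if "M \<in> set Ms" for M using that Ns sub by blast
  hence "\<exists>M\<in>set Ms. \<exists>k<dim_col M. col (block_row n Ms) j = col M k"
    using j by (rule col_block_row_member)
  then obtain M k
    where M: "M \<in> set Ms" "k < dim_col M" "col (block_row n Ms) j = col M k"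
    by (elim bexE exE conjE)
  have "M \<in> set Ns" using M(1) sub by blast
  with Ns show "col (block_row n Ms) j \<in> col_range (block_row n Ns)"
    unfolding M(3) using M(2) by (rule block_col_in_col_range)
qed

lemma mult_pow_mat:
  assumes "A \<in> carrier_mat n n"
  shows "A * A ^\<^sub>m k = A ^\<^sub>m Suc k"
proof (induction k)
  case (Suc k)
  have "A * A ^\<^sub>m Suc k = (A * A ^\<^sub>m k) * A"
    using assms by (simp add: assoc_mult_mat[of _ n n _ n _ n])
  thus ?case using Suc by simp
qed (use assms in simp)

lemma the_mat_inverse:
  fixes A :: "real mat"
  assumes A: "A \<in> carrier_mat n n" and inv: "invertible_mat A"
  shows "the (mat_inverse A) \<in> carrier_mat n n" "A * the (mat_inverse A) = 1\<^sub>m n"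
    "the (mat_inverse A) * A = 1\<^sub>m n"
proof -
  obtain B where B: "A * B = 1\<^sub>m n" "B * A = 1\<^sub>m (dim_row B)"
    using inv A unfolding invertible_mat_def inverts_mat_def by auto
  have dB: "B \<in> carrier_mat n n"
    using B A by (metis carrier_matD(2) carrier_mat_triv index_mult_mat(3) index_one_mat(3))
  have "A \<in> Units (ring_mat TYPE(real) n ())"
    using A B dB by (auto simp: Units_def ring_mat_def)
  then obtain C where "mat_inverse A = Some C"
    using mat_inverse(1)[OF A] by (metis not_Some_eq)
  thus "the (mat_inverse A) \<in> carrier_mat n n" "A * the (mat_inverse A) = 1\<^sub>m n"
    "the (mat_inverse A) * A = 1\<^sub>m n"
    using mat_inverse(2)[OF A] by auto
qed

lemma invertible_mat_transpose:
  assumes B: "B \<in> carrier_mat n n" and inv: "invertible_mat (B :: real mat)"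
  shows "invertible_mat (transpose_mat B)"
proof -
  let ?C = "the (mat_inverse B)"
  have C: "?C \<in> carrier_mat n n" "B * ?C = 1\<^sub>m n" "?C * B = 1\<^sub>m n"
    using the_mat_inverse[OF B inv] by auto
  have "transpose_mat B * transpose_mat ?C = 1\<^sub>m n" "transpose_mat ?C * transpose_mat B = 1\<^sub>m n"
    using B C by (simp_all flip: transpose_mult)
  thus ?thesis
    using B C(1) unfolding invertible_mat_def inverts_mat_def by auto
qed

lemma mat_powi_carrier:
  assumes "A \<in> carrier_mat n n" "invertible_mat A"
  shows "mat_powi A k \<in> carrier_mat n n"
  using assms the_mat_inverse(1)[OF assms] by (simp add: mat_powi_def)

text \<open>The definition of \<^const>\<open>mat_powi\<close> switches from \<open>A\<close> to its inverse between the exponents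
  \<open>-1\<close> and \<open>0\<close>; nonsingularity makes the law of exponents hold across the switch.\<close>

lemma mult_mat_powi:
  assumes A: "A \<in> carrier_mat n n" and inv: "invertible_mat A"
  shows "A * mat_powi A k = mat_powi A (k + 1)"
proof (cases "k \<ge> 0")
  case True
  hence "nat (k + 1) = Suc (nat k)" by simp
  thus ?thesis using True mult_pow_mat[OF A, of "nat k"] by (simp add: mat_powi_def)
next
  case False
  define C where "C = the (mat_inverse A)"
  have C: "C \<in> carrier_mat n n" "A * C = 1\<^sub>m n"
    using the_mat_inverse[OF A inv] by (simp_all add: C_def)
  define l where "l = nat (- (k + 1))"
  have l: "nat (- k) = Suc l" using False by (simp add: l_def)
  have "A * C ^\<^sub>m Suc l = A * C * C ^\<^sub>m l"
    using A C mult_pow_mat[OF C(1), of l] assoc_mult_mat[OF A C(1) pow_carrier_mat[OF C(1)], of l]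
    by simp
  also have "\<dots> = C ^\<^sub>m l" using C by simp
  also have "\<dots> = mat_powi A (k + 1)"
  proof (cases "k = -1")
    case True
    thus ?thesis using A C by (simp add: mat_powi_def l_def)
  next
    case k: False
    have "\<not> 0 \<le> k + 1" using k False by linarith
    thus ?thesis by (simp add: mat_powi_def l_def C_def)
  qed
  finally show ?thesis using False l by (simp add: mat_powi_def C_def)
qed

lemma krylov_shift:
  assumes A: "A \<in> carrier_mat n n" and E: "E \<in> carrier_mat n s"
    and inv: "kind = Extended \<Longrightarrow> invertible_mat A"
    and v: "v \<in> krylov kind j A E"
  shows "A *\<^sub>v v \<in> krylov kind (Suc j) A E"
proof (cases kind)
  case Block
  have step: "A * (A ^\<^sub>m i * E) = A ^\<^sub>m Suc i * E" for i
    using A E mult_pow_mat[OF A, of i] assoc_mult_mat[of A n n "A ^\<^sub>m i" n E s] by simp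
  have "A *\<^sub>v v \<in> col_range (block_row n (map (\<lambda>i. A ^\<^sub>m i * E) [0..<Suc j]))"
  proof (rule mult_col_range_block_row[OF A])
    show "v \<in> col_range (block_row n (map (\<lambda>i. A ^\<^sub>m i * E) [0..<j]))"
      using v A by (simp add: Block)
    fix M assume "M \<in> set (map (\<lambda>i. A ^\<^sub>m i * E) [0..<j])"
    then obtain i where i: "i < j" "M = A ^\<^sub>m i * E" by auto
    thus "dim_row M = n" using A by simp
    have "A * M = A ^\<^sub>m Suc i * E" using i step by simp
    moreover have "Suc i \<in> set [0..<Suc j]" using i(1) by (simp del: upt_Suc)
    ultimately show "A * M \<in> set (map (\<lambda>i. A ^\<^sub>m i * E) [0..<Suc j])"
      unfolding set_map by (rule image_eqI)
  qed (use A in auto)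
  thus ?thesis using A by (simp add: Block)
next
  case Extended
  note inv = inv[OF Extended]
  have step: "A * (mat_powi A i * E) = mat_powi A (i + 1) * E" for i
    using A E mult_mat_powi[OF A inv, of i] mat_powi_carrier[OF A inv, of i]
      assoc_mult_mat[of A n n "mat_powi A i" n E s] by simp
  have dim: "dim_row (mat_powi A i * E) = n" for i
    using mat_powi_carrier[OF A inv, of i] by simp
  have "A *\<^sub>v v \<in> col_range (block_row n
      (map (\<lambda>i. mat_powi A i * E) [- int (Suc j)..int (Suc j) - 1]))"
  proof (rule mult_col_range_block_row[OF A])
    show "v \<in> col_range (block_row n (map (\<lambda>i. mat_powi A i * E) [- int j..int j - 1]))"
      using v A by (simp add: Extended)
    fix M assume "M \<in> set (map (\<lambda>i. mat_powi A i * E) [- int j..int j - 1])"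
    then obtain i where i: "i \<in> {- int j..int j - 1}" "M = mat_powi A i * E" by auto
    thus "dim_row M = n" using dim by simp
    have "A * M = mat_powi A (i + 1) * E" using i step by simp
    moreover have "i + 1 \<in> set [- int (Suc j)..int (Suc j) - 1]" using i by simp
    ultimately show "A * M \<in> set (map (\<lambda>i. mat_powi A i * E) [- int (Suc j)..int (Suc j) - 1])"
      unfolding set_map by (rule image_eqI)
  qed (use dim in auto)
  thus ?thesis using A by (simp add: Extended)
qed

lemma krylov_mono:
  assumes A: "A \<in> carrier_mat n n" and E: "E \<in> carrier_mat n s"
    and inv: "kind = Extended \<Longrightarrow> invertible_mat A"
  shows "krylov kind j A E \<subseteq> krylov kind (Suc j) A E"
proof (cases kind)
  case Block
  show ?thesis unfolding Block krylov.simps using A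
    by (intro col_range_block_row_mono) auto
next
  case Extended
  show ?thesis unfolding Extended krylov.simps
    using A mat_powi_carrier[OF A inv[OF Extended], THEN carrier_matD(1)]
    by (intro col_range_block_row_mono) auto
qed

lemma start_col_in_krylov:
  assumes A: "A \<in> carrier_mat n n" and E: "E \<in> carrier_mat n s"
    and inv: "kind = Extended \<Longrightarrow> invertible_mat A" and j: "j \<ge> 1" and k: "k < s"
  shows "col E k \<in> krylov kind j A E"
proof (cases kind)
  case Block
  have "E = A ^\<^sub>m 0 * E" using A E by simp
  moreover have "0 \<in> set [0..<j]" using j by simp
  ultimately have "E \<in> set (map (\<lambda>i. A ^\<^sub>m i * E) [0..<j])"
    unfolding set_map by (rule image_eqI)
  thus ?thesis unfolding Block krylov.simps using A E k
    by (intro block_col_in_col_range) auto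
next
  case Extended
  have "E = mat_powi A 0 * E" using A E by (simp add: mat_powi_def)
  moreover have "0 \<in> set [- int j..int j - 1]" using j by simp
  ultimately have "E \<in> set (map (\<lambda>i. mat_powi A i * E) [- int j..int j - 1])"
    unfolding set_map by (rule image_eqI)
  thus ?thesis unfolding Extended krylov.simps
    using A E k mat_powi_carrier[OF A inv[OF Extended], THEN carrier_matD(1)]
    by (intro block_col_in_col_range) auto
qed

section \<open>The Arnoldi relation\<close>

text \<open>Expanding \<open>Q * Q\<^sup>T\<close> as the sum of \<open>c * c\<^sup>T\<close> over the columns \<open>c\<close> of \<open>Q\<close> makes it additive
  under concatenation. The projectors onto successive Krylov spaces therefore differ by
  \<open>V * V\<^sup>T\<close> for the new block \<open>V\<close>.\<close>

lemma mat_of_cols_mult_transpose_append: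
  fixes cs ds :: "real vec list"
  shows "mat_of_cols n (cs @ ds) * transpose_mat (mat_of_cols n (cs @ ds)) =
    mat_of_cols n cs * transpose_mat (mat_of_cols n cs) +
    mat_of_cols n ds * transpose_mat (mat_of_cols n ds)"
proof -
  have entry: "(mat_of_cols n es * transpose_mat (mat_of_cols n es)) $$ (i, k) =
      (\<Sum>e\<leftarrow>es. e $ i * e $ k)" if "i < n" "k < n" for es :: "real vec list" and i k
    using that by (simp add: scalar_prod_def mat_of_cols_index sum_list_sum_nth)
  show ?thesis
    by (intro eq_matI) (auto simp: entry simp del: index_mult_mat(1))
qed

lemma collect_blocks_carrier:
  assumes "\<And>i. 1 \<le> i \<Longrightarrow> i \<le> j \<Longrightarrow> V i \<in> carrier_mat n d"
  shows "collect_blocks n V j \<in> carrier_mat n (j * d)"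
proof -
  have "sum_list (map (\<lambda>i. length (cols (V i))) [1..<Suc j]) = sum_list (map (\<lambda>_. d) [1..<Suc j])"
    using assms by (intro arg_cong[where f = sum_list] map_cong refl) (simp del: upt_Suc, force)
  hence "length (concat (map cols (map V [1..<Suc j]))) = j * d"
    by (simp add: length_concat o_def sum_list_triv del: upt_Suc)
  thus ?thesis
    unfolding collect_blocks_def block_row_def using mat_of_cols_carrier(1) by metis
qed

lemma collect_blocks_projector_Suc:
  assumes "V (Suc j) \<in> carrier_mat n d"
  shows "collect_blocks n V (Suc j) * transpose_mat (collect_blocks n V (Suc j)) =
    collect_blocks n V j * transpose_mat (collect_blocks n V j) +
    V (Suc j) * transpose_mat (V (Suc j))"
proof -
  have "mat_of_cols n (cols (V (Suc j))) = V (Suc j)"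
    using assms mat_of_cols_cols[of "V (Suc j)"] by auto
  thus ?thesis
    using mat_of_cols_mult_transpose_append[of n "concat (map cols (map V [1..<Suc j]))"
        "cols (V (Suc j))"]
    by (simp add: collect_blocks_def block_row_def)
qed

lemma arnoldi_blocks_carrier:
  assumes A: "A \<in> carrier_mat n n" and E: "E \<in> carrier_mat n s"
    and V: "arnoldi_blocks kind A E k V"
  shows "1 \<le> j \<Longrightarrow> j \<le> k \<Longrightarrow> V j \<in> carrier_mat n (block_width kind s)"
    and "j \<le> k \<Longrightarrow> collect_blocks n V j \<in> carrier_mat n (j * block_width kind s)"
proof -
  show *: "V j \<in> carrier_mat n (block_width kind s)" if "1 \<le> j" "j \<le> k" for j
    using V that A E by (auto simp: arnoldi_blocks_def)
  show "collect_blocks n V j \<in> carrier_mat n (j * block_width kind s)" if "j \<le> k"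
    using * that by (intro collect_blocks_carrier) auto
qed

text \<open>
  Let \<open>R j\<close> collect the first \<open>j\<close> blocks, let \<open>P j = R j * (R j)\<^sup>T\<close> be the projector onto the
  \<open>j\<close>-th Krylov space, and let \<open>VV\<close>, \<open>U\<close> be the increments \<open>P (m + 1) - P m\<close>,
  \<open>P m - P (m - 1)\<close> contributed by the blocks \<open>V (m + 1)\<close>, \<open>V m\<close>. Then:
  \<^item> \<open>VV * A * R (m - 1) = 0\<close>, as the columns of \<open>A * R (m - 1)\<close> already lie in the \<open>m\<close>-th space;
  \<^item> hence \<open>VV * A * R m = VV * A * U * R m\<close>, because \<open>R m - U * R m = P (m - 1) * R m\<close> factors
    through \<open>R (m - 1)\<close>;
  \<^item> the right side is the correction times \<open>R m\<close>, and the left side is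
    \<open>A * R m - P m * A * R m\<close>, as the columns of \<open>A * R m\<close> lie in the \<open>(m + 1)\<close>-st space.

  Working with projectors avoids cutting \<open>R m\<close> and \<open>(R m)\<^sup>T * A * R m\<close> into blocks.
\<close>

lemma arnoldi_relation:
  fixes A E :: "real mat"
  assumes A: "A \<in> carrier_mat n n" and E: "E \<in> carrier_mat n s"
    and inv: "kind = Extended \<Longrightarrow> invertible_mat A"
    and V: "arnoldi_blocks kind A E (Suc m) V" and m: "m \<ge> 1"
    and Q: "Q = collect_blocks n V m"
  shows "(A - V (Suc m) * (transpose_mat (V (Suc m)) * A * V m) * transpose_mat (V m)) * Q =
      Q * (transpose_mat Q * A * Q)" (is "(A - ?F) * Q = _")
    and "Q * (transpose_mat Q * E) = E"
proof -
  define d where "d = block_width kind s"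
  define R where "R = collect_blocks n V"
  define K where "K j = krylov kind j A E" for j
  have Vc: "V j \<in> carrier_mat n d" if "1 \<le> j" "j \<le> Suc m" for j
    unfolding d_def using A E V that by (rule arnoldi_blocks_carrier)
  have Rc: "R j \<in> carrier_mat n (j * d)" if "j \<le> Suc m" for j
    unfolding d_def R_def using A E V that by (rule arnoldi_blocks_carrier)
  have onb: "orthonormal_basis_cols (R j) (K j)" if "1 \<le> j" "j \<le> Suc m" for j
    using V that A unfolding arnoldi_blocks_def R_def K_def by auto
  define P where "P j = R j * transpose_mat (R j)" for j
  have Pc: "P j \<in> carrier_mat n n" if "j \<le> Suc m" for j
    using Rc[OF that] by (simp add: P_def)
  have fixes_K: "P j * M = M"
    if "1 \<le> j" "j \<le> Suc m" "M \<in> carrier_mat n r" "\<And>k. k < r \<Longrightarrow> col M k \<in> K j" for j M r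
    unfolding P_def using orthogonal_projector_fixes[OF Rc onb] that by blast
  have P_Suc: "P (Suc j) = P j + V (Suc j) * transpose_mat (V (Suc j))" if "j \<le> m" for j
    unfolding P_def R_def using Vc that by (intro collect_blocks_projector_Suc) auto
  \<comment> \<open>The case \<open>j = 0\<close> is included, as \<open>R 0\<close> has no columns; it is needed as \<open>m - 1\<close> when \<open>m = 1\<close>.\<close>
  have cols_R: "col (R j) k \<in> K j" if "j \<le> Suc m" "k < j * d" for j k
  proof -
    have "j \<ge> 1" using that by (cases j) auto
    thus ?thesis using onb[of j] that Rc[of j] col_in_col_range[of k "R j"]
      by (auto simp: orthonormal_basis_cols_def)
  qed
  have cols_AR: "col (A * R j) k \<in> K (Suc j)" if "j \<le> Suc m" "k < j * d" for j k
    using krylov_shift[OF A E inv] cols_R[OF that]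
    by (simp add: col_mult2[OF A Rc[OF that(1)] that(2)] K_def)
  obtain l where l: "m = Suc l" using m by (cases m) auto
  define VV where "VV = V (Suc m) * transpose_mat (V (Suc m))"
  define U where "U = V m * transpose_mat (V m)"
  have Vm: "V m \<in> carrier_mat n d" using Vc m by simp
  note Vm1 = Vc[of "Suc m"] and Rm = Rc[of m] and Rl = Rc[of l]
  have VV: "VV \<in> carrier_mat n n" and U: "U \<in> carrier_mat n n"
    using Vm Vm1 by (auto simp: VV_def U_def)
  have P_m1: "P (Suc m) = P m + VV" using P_Suc[of m] by (simp add: VV_def)
  have P_m: "P m = P l + U" using P_Suc[of l] l by (simp add: U_def)
  have AR: "A * R j \<in> carrier_mat n (j * d)" if "j \<le> Suc m" for j using A Rc[OF that] by simp

  have diff: "VV * M = P (Suc m) * M - P m * M" if "M \<in> carrier_mat n r" for M r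
  proof -
    have "P (Suc m) * M = P m * M + VV * M"
      using that VV Pc[of m] by (simp add: P_m1 add_mult_distrib_mat[of _ n n _ _ r])
    moreover have "P m * M \<in> carrier_mat n r" "VV * M \<in> carrier_mat n r"
      using that VV Pc[of m] by auto
    moreover have "Z = (Y + Z) - Y" if "Y \<in> carrier_mat n r" "Z \<in> carrier_mat n r" for Y Z :: "real mat"
      using that by (intro eq_matI) auto
    ultimately show ?thesis by simp
  qed
  have VV_AR_l: "VV * (A * R l) = 0\<^sub>m n (l * d)"
  proof -
    have "P m * (A * R l) = A * R l"
      using AR[of l] cols_AR[of l] l by (intro fixes_K) auto
    moreover have "P (Suc m) * (A * R l) = A * R l"
      using AR[of l] cols_AR[of l] l krylov_mono[OF A E inv, where j = m]
      by (intro fixes_K) (auto simp: K_def)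
    ultimately show ?thesis using diff[OF AR[of l]] AR[of l] l by auto
  qed
  have VV_AR_m: "VV * (A * R m) = A * R m - P m * (A * R m)"
  proof -
    have "P (Suc m) * (A * R m) = A * R m"
      using AR[of m] cols_AR[of m] by (intro fixes_K) auto
    thus ?thesis using diff[OF AR[of m]] by simp
  qed
  have R_split: "R m = R l * (transpose_mat (R l) * R m) + U * R m"
  proof -
    have "R m = P m * R m"
      using Rm cols_R[of m] m by (intro fixes_K[symmetric]) auto
    also have "\<dots> = P l * R m + U * R m"
      unfolding P_m using Rm U Pc[of l] l by (intro add_mult_distrib_mat) auto
    also have "P l * R m = R l * (transpose_mat (R l) * R m)"
      unfolding P_def using Rm Rl l by (intro assoc_mult_mat) auto
    finally show ?thesis .
  qed
  have F: "?F = VV * (A * U)"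
  proof -
    have "?F = V (Suc m) * (transpose_mat (V (Suc m)) * A * V m * transpose_mat (V m))"
      using Vm Vm1 A by (simp add: assoc_mult_mat[of _ n d _ d _ n])
    also have "transpose_mat (V (Suc m)) * A * V m * transpose_mat (V m) =
        transpose_mat (V (Suc m)) * A * U"
      unfolding U_def using Vm Vm1 A by (intro assoc_mult_mat) auto
    also have "\<dots> = transpose_mat (V (Suc m)) * (A * U)"
      using Vm1 A U by (intro assoc_mult_mat) auto
    also have "V (Suc m) * \<dots> = VV * (A * U)"
      unfolding VV_def using Vm1 A U by (intro assoc_mult_mat[symmetric]) auto
    finally show ?thesis .
  qed
  have "VV * (A * R m) = ?F * R m"
  proof -
    define Z where "Z = transpose_mat (R l) * R m"
    have Z: "Z \<in> carrier_mat (l * d) (m * d)" using Rl Rm l by (simp add: Z_def)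
    have UR: "U * R m \<in> carrier_mat n (m * d)" using U Rm by simp
    have "A * R m = A * (R l * Z + U * R m)" using R_split by (simp add: Z_def)
    also have "\<dots> = A * (R l * Z) + A * (U * R m)"
      using Rl l Z UR by (intro mult_add_distrib_mat[OF A]) auto
    also have "A * (R l * Z) = A * R l * Z"
      using A Rl l Z by (intro assoc_mult_mat[symmetric]) auto
    also have "VV * (A * R l * Z + A * (U * R m)) = VV * (A * R l * Z) + VV * (A * (U * R m))"
      using A Rl l Z UR by (intro mult_add_distrib_mat[OF VV]) auto
    also have "VV * (A * R l * Z) = VV * (A * R l) * Z"
      using VV AR[of l] l Z by (intro assoc_mult_mat[symmetric]) auto
    also have "\<dots> = 0\<^sub>m n (m * d)" using Z by (simp add: VV_AR_l)
    also have "A * (U * R m) = A * U * R m"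
      using A U Rm by (intro assoc_mult_mat[symmetric]) auto
    also have "VV * (A * U * R m) = ?F * R m"
      unfolding F using A U VV Rm by (intro assoc_mult_mat[symmetric]) auto
    finally show ?thesis
      unfolding F using left_add_zero_mat[OF mult_carrier_mat[OF mult_carrier_mat[OF VV
            mult_carrier_mat[OF A U]] Rm]] by simp
  qed
  hence FR: "?F * R m = A * R m - P m * (A * R m)" using VV_AR_m by simp
  have Q': "Q = R m" by (simp add: Q R_def)
  have Fc: "?F \<in> carrier_mat n n" using F VV A U by simp
  have "(A - ?F) * R m = A * R m - ?F * R m"
    using A Fc Rm by (intro minus_mult_distrib_mat) auto
  also have "\<dots> = P m * (A * R m)"
    unfolding FR using AR[of m] Pc[of m] by (intro eq_matI) auto
  also have "\<dots> = R m * (transpose_mat (R m) * (A * R m))"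
    unfolding P_def using Rm AR[of m] by (intro assoc_mult_mat) auto
  also have "transpose_mat (R m) * (A * R m) = transpose_mat (R m) * A * R m"
    using Rm A by (intro assoc_mult_mat[symmetric]) auto
  finally show "(A - ?F) * Q = Q * (transpose_mat Q * A * Q)" by (simp add: Q')
  have "P m * E = E"
    using E start_col_in_krylov[OF A E inv m] m by (intro fixes_K) (auto simp: K_def)
  moreover have "P m * E = R m * (transpose_mat (R m) * E)"
    unfolding P_def using Rm E by (intro assoc_mult_mat) auto
  ultimately show "Q * (transpose_mat Q * E) = E" by (simp add: Q')
qed

section \<open>Entrywise calculus of matrix functions\<close>

lemma mat_mult_entry:
  fixes M N :: "real mat"
  assumes "M \<in> carrier_mat n k" "N \<in> carrier_mat k r" "i < n" "j < r"
  shows "(M * N) $$ (i, j) = (\<Sum>l<k. M $$ (i, l) * N $$ (l, j))"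
  using assms by (simp add: scalar_prod_def lessThan_atLeast0)

text \<open>Fixes the dimensions by a carrier, so that the dimensions of a derivative given as a compound
  term need not be computed.\<close>

lemma has_mat_derivative_within_iff:
  assumes "D \<in> carrier_mat nr nc"
  shows "has_mat_derivative_within f D t S \<longleftrightarrow>
    (\<forall>u\<in>S. f u \<in> carrier_mat nr nc) \<and>
    (\<forall>i<nr. \<forall>j<nc. ((\<lambda>u. f u $$ (i, j)) has_real_derivative D $$ (i, j)) (at t within S))"
  using assms by (simp add: has_mat_derivative_within_def)

lemma has_mat_derivative_within_mult:
  assumes f: "has_mat_derivative_within f f' t S" and g: "has_mat_derivative_within g g' t S"
    and f': "f' \<in> carrier_mat n k" and g': "g' \<in> carrier_mat k r" and t: "t \<in> S"
  shows "has_mat_derivative_within (\<lambda>u. f u * g u) (f' * g t + f t * g') t S"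
proof -
  have fc: "f u \<in> carrier_mat n k" and gc: "g u \<in> carrier_mat k r" if "u \<in> S" for u
    using f g f' g' that by (auto simp: has_mat_derivative_within_def)
  have "((\<lambda>u. (f u * g u) $$ (i, j)) has_real_derivative (f' * g t + f t * g') $$ (i, j))
      (at t within S)" if i: "i < n" and j: "j < r" for i j
  proof -
    have "((\<lambda>u. \<Sum>l<k. f u $$ (i, l) * g u $$ (l, j)) has_real_derivative
        (\<Sum>l<k. f' $$ (i, l) * g t $$ (l, j) + f t $$ (i, l) * g' $$ (l, j))) (at t within S)"
      using f g f' g' i j
      by (auto intro!: derivative_eq_intros sum.cong simp: has_mat_derivative_within_def)
    moreover have "(f' * g t + f t * g') $$ (i, j) =
        (\<Sum>l<k. f' $$ (i, l) * g t $$ (l, j) + f t $$ (i, l) * g' $$ (l, j))"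
      using fc[OF t] gc[OF t] f' g' i j
      by (simp add: mat_mult_entry[of _ n k _ r] sum.distrib del: index_mult_mat(1))
    ultimately show ?thesis
      using fc gc i j
      by (auto simp: mat_mult_entry[of _ n k _ r] simp del: index_mult_mat(1)
          intro: has_field_derivative_transform_within[where d = 1, OF _ _ t])
  qed
  moreover have "f u * g u \<in> carrier_mat n r" if "u \<in> S" for u
    using fc[OF that] gc[OF that] by simp
  moreover have "f' * g t + f t * g' \<in> carrier_mat n r" using fc[OF t] g' by simp
  ultimately show ?thesis by (subst has_mat_derivative_within_iff) blast+
qed

lemma has_mat_derivative_within_const:
  "has_mat_derivative_within (\<lambda>_. C) (0\<^sub>m (dim_row C) (dim_col C)) t S"
  by (auto simp: has_mat_derivative_within_def)

lemma has_mat_derivative_within_mult_left: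
  assumes f: "has_mat_derivative_within f f' t S"
    and C: "C \<in> carrier_mat n k" and f': "f' \<in> carrier_mat k r" and t: "t \<in> S"
  shows "has_mat_derivative_within (\<lambda>u. C * f u) (C * f') t S"
proof -
  have "f t \<in> carrier_mat k r" using f f' t by (auto simp: has_mat_derivative_within_def)
  thus ?thesis
    using has_mat_derivative_within_mult[OF has_mat_derivative_within_const[of C] f _ f' t, of n] C f'
    by auto
qed

lemma has_mat_derivative_within_mult_right:
  assumes f: "has_mat_derivative_within f f' t S"
    and f': "f' \<in> carrier_mat n k" and C: "C \<in> carrier_mat k r" and t: "t \<in> S"
  shows "has_mat_derivative_within (\<lambda>u. f u * C) (f' * C) t S"
proof -
  have "f t \<in> carrier_mat n k" using f f' t by (auto simp: has_mat_derivative_within_def)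
  thus ?thesis
    using has_mat_derivative_within_mult[OF f has_mat_derivative_within_const[of C] f' _ t, of r] C f'
    by auto
qed

section \<open>The matrix exponential\<close>

text \<open>The sum of the absolute values of all entries is a submultiplicative norm, so the entries of
  powers grow at most geometrically and each entry of the exponential series converges
  everywhere.\<close>

lemma abs_pow_mat_entry_le:
  fixes M :: "real mat"
  assumes M: "M \<in> carrier_mat n n" and i: "i < n" and j: "j < n"
  shows "\<bar>(M ^\<^sub>m k) $$ (i, j)\<bar> \<le> (\<Sum>l<n. \<Sum>r<n. \<bar>M $$ (l, r)\<bar>) ^ k"
  using j
proof (induction k arbitrary: j)
  case 0
  thus ?case using M i by simp
next
  case (Suc k)
  let ?c = "\<Sum>l<n. \<Sum>r<n. \<bar>M $$ (l, r)\<bar>"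
  have c: "?c \<ge> 0" by (intro sum_nonneg) auto
  have "\<bar>(M ^\<^sub>m Suc k) $$ (i, j)\<bar> = \<bar>\<Sum>l<n. (M ^\<^sub>m k) $$ (i, l) * M $$ (l, j)\<bar>"
    using M i Suc.prems
    by (simp add: mat_mult_entry[of _ n n _ n] pow_carrier_mat del: index_mult_mat(1))
  also have "\<dots> \<le> (\<Sum>l<n. \<bar>(M ^\<^sub>m k) $$ (i, l)\<bar> * \<bar>M $$ (l, j)\<bar>)"
    by (rule order_trans[OF sum_abs]) (simp add: abs_mult)
  also have "\<dots> \<le> (\<Sum>l<n. ?c ^ k * (\<Sum>r<n. \<bar>M $$ (l, r)\<bar>))"
    using Suc c by (intro sum_mono mult_mono member_le_sum) (auto intro!: zero_le_power)
  also have "\<dots> = ?c ^ Suc k" by (simp add: sum_distrib_right mult.commute)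
  finally show ?case .
qed

lemma summable_mat_exp_series:
  fixes M :: "real mat"
  assumes "M \<in> carrier_mat n n" "i < n" "j < n"
  shows "summable (\<lambda>k. (M ^\<^sub>m k) $$ (i, j) / fact k * y ^ k)"
proof (rule summable_comparison_test')
  let ?c = "\<Sum>l<n. \<Sum>r<n. \<bar>M $$ (l, r)\<bar>"
  show "summable (\<lambda>k. inverse (fact k) * (?c * \<bar>y\<bar>) ^ k)" by (rule summable_exp)
  show "norm ((M ^\<^sub>m k) $$ (i, j) / fact k * y ^ k) \<le> inverse (fact k) * (?c * \<bar>y\<bar>) ^ k" for k
    using mult_right_mono[OF abs_pow_mat_entry_le[OF assms, of k], of "\<bar>y\<bar> ^ k / fact k"]
    by (simp add: abs_mult power_abs power_mult_distrib field_simps)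
qed

lemma pow_smult_mat:
  fixes M :: "real mat"
  assumes M: "M \<in> carrier_mat n n"
  shows "(y \<cdot>\<^sub>m M) ^\<^sub>m k = y ^ k \<cdot>\<^sub>m M ^\<^sub>m k"
proof (induction k)
  case (Suc k)
  have "(y \<cdot>\<^sub>m M) ^\<^sub>m Suc k = y ^ k \<cdot>\<^sub>m M ^\<^sub>m k * (y \<cdot>\<^sub>m M)" using Suc by simp
  also have "\<dots> = y ^ Suc k \<cdot>\<^sub>m (M ^\<^sub>m k * M)"
    using M by (intro eq_matI) auto
  finally show ?case by simp
qed (use M in \<open>auto intro!: eq_matI\<close>)

lemma mat_exp_carrier: "M \<in> carrier_mat n n \<Longrightarrow> mat_exp M \<in> carrier_mat n n"
  by (simp add: mat_exp_def)

lemma mat_exp_smult_entry: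
  fixes M :: "real mat"
  assumes M: "M \<in> carrier_mat n n" and "i < n" "j < n"
  shows "mat_exp (y \<cdot>\<^sub>m M) $$ (i, j) = (\<Sum>k. (M ^\<^sub>m k) $$ (i, j) / fact k * y ^ k)"
proof -
  have "((y \<cdot>\<^sub>m M) ^\<^sub>m k) $$ (i, j) / fact k = (M ^\<^sub>m k) $$ (i, j) / fact k * y ^ k" for k
    using assms pow_carrier_mat[OF M, of k] by (simp add: pow_smult_mat[OF M])
  thus ?thesis using assms by (simp add: mat_exp_def)
qed

lemma mat_exp_zero_smult:
  assumes "M \<in> carrier_mat n n"
  shows "mat_exp (0 \<cdot>\<^sub>m M) = 1\<^sub>m n"
proof (rule eq_matI)
  fix i j assume ij: "i < dim_row (1\<^sub>m n :: real mat)" "j < dim_col (1\<^sub>m n :: real mat)"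
  show "mat_exp (0 \<cdot>\<^sub>m M) $$ (i, j) = 1\<^sub>m n $$ (i, j)"
    using ij assms mat_exp_smult_entry[OF assms, of i j 0]
      powser_zero[of "\<lambda>k. (M ^\<^sub>m k) $$ (i, j) / fact k"] by simp
qed (use assms in \<open>auto simp: mat_exp_def\<close>)

text \<open>Each entry of \<open>exp(u M)\<close> is an everywhere convergent power series in \<open>u\<close>, differentiated
  term by term.\<close>

lemma has_real_derivative_mat_exp_entry:
  fixes M :: "real mat"
  assumes M: "M \<in> carrier_mat n n" and ij: "i < n" "j < n"
  shows "((\<lambda>u. mat_exp (u \<cdot>\<^sub>m M) $$ (i, j)) has_real_derivative
      (\<Sum>k. (M ^\<^sub>m Suc k) $$ (i, j) / fact k * t ^ k)) (at t)"
proof -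
  have "diffs (\<lambda>k. (M ^\<^sub>m k) $$ (i, j) / fact k) = (\<lambda>k. (M ^\<^sub>m Suc k) $$ (i, j) / fact k)"
    by (rule ext) (simp add: diffs_def divide_simps del: pow_mat.simps of_nat_Suc)
  thus ?thesis
    using termdiffs_strong_converges_everywhere[OF summable_mat_exp_series[OF M ij], of t]
    by (simp add: mat_exp_smult_entry[OF M ij] del: pow_mat.simps)
qed

text \<open>Both forms come from the same series, splitting \<open>M ^ (k + 1)\<close> as \<open>M * M ^ k\<close> or as
  \<open>M ^ k * M\<close>. The Sylvester equation needs the first for the left and the second for the right
  exponential factor.\<close>

lemma has_mat_derivative_mat_exp:
  fixes M :: "real mat"
  assumes M: "M \<in> carrier_mat n n"
  shows "has_mat_derivative_within (\<lambda>u. mat_exp (u \<cdot>\<^sub>m M)) (M * mat_exp (t \<cdot>\<^sub>m M)) t S"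
    and "has_mat_derivative_within (\<lambda>u. mat_exp (u \<cdot>\<^sub>m M)) (mat_exp (t \<cdot>\<^sub>m M) * M) t S"
proof -
  have c: "mat_exp (u \<cdot>\<^sub>m M) \<in> carrier_mat n n" for u using M by (simp add: mat_exp_carrier)
  have left: "(\<Sum>k. (M ^\<^sub>m Suc k) $$ (i, j) / fact k * t ^ k) = (M * mat_exp (t \<cdot>\<^sub>m M)) $$ (i, j)"
    if ij: "i < n" "j < n" for i j
  proof -
    have "(\<Sum>k. (M ^\<^sub>m Suc k) $$ (i, j) / fact k * t ^ k) =
        (\<Sum>k. \<Sum>l<n. M $$ (i, l) * ((M ^\<^sub>m k) $$ (l, j) / fact k * t ^ k))"
      using M ij mat_mult_entry[OF M pow_carrier_mat[OF M] ij]
      by (simp add: mult_pow_mat[OF M, symmetric] sum_divide_distrib sum_distrib_right mult.assoc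
          del: pow_mat.simps index_mult_mat(1))
    also have "\<dots> = (\<Sum>l<n. \<Sum>k. M $$ (i, l) * ((M ^\<^sub>m k) $$ (l, j) / fact k * t ^ k))"
      using M ij by (intro suminf_sum summable_mult summable_mat_exp_series) auto
    also have "\<dots> = (\<Sum>l<n. M $$ (i, l) * mat_exp (t \<cdot>\<^sub>m M) $$ (l, j))"
      using ij by (intro sum.cong refl)
        (simp add: mat_exp_smult_entry[OF M] suminf_mult summable_mat_exp_series[OF M]
          del: times_divide_eq_left times_divide_eq_right)
    finally show ?thesis using mat_mult_entry[OF M c ij] by simp
  qed
  have right: "(\<Sum>k. (M ^\<^sub>m Suc k) $$ (i, j) / fact k * t ^ k) = (mat_exp (t \<cdot>\<^sub>m M) * M) $$ (i, j)"
    if ij: "i < n" "j < n" for i j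
  proof -
    have "(\<Sum>k. (M ^\<^sub>m Suc k) $$ (i, j) / fact k * t ^ k) =
        (\<Sum>k. \<Sum>l<n. ((M ^\<^sub>m k) $$ (i, l) / fact k * t ^ k) * M $$ (l, j))"
      using M ij mat_mult_entry[OF pow_carrier_mat[OF M] M ij]
      by (simp add: sum_divide_distrib sum_distrib_left mult_ac
          del: index_mult_mat(1))
    also have "\<dots> = (\<Sum>l<n. \<Sum>k. ((M ^\<^sub>m k) $$ (i, l) / fact k * t ^ k) * M $$ (l, j))"
      using M ij by (intro suminf_sum summable_mult2 summable_mat_exp_series) auto
    also have "\<dots> = (\<Sum>l<n. mat_exp (t \<cdot>\<^sub>m M) $$ (i, l) * M $$ (l, j))"
      using ij by (intro sum.cong refl)
        (simp add: mat_exp_smult_entry[OF M] suminf_mult2 summable_mat_exp_series[OF M]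
          del: times_divide_eq_left times_divide_eq_right)
    finally show ?thesis using mat_mult_entry[OF c M ij] by simp
  qed
  show "has_mat_derivative_within (\<lambda>u. mat_exp (u \<cdot>\<^sub>m M)) (M * mat_exp (t \<cdot>\<^sub>m M)) t S"
    using c has_real_derivative_mat_exp_entry[OF M, THEN has_field_derivative_at_within, of _ _ t S]
    by (subst has_mat_derivative_within_iff[of _ n n])
      (use M c in \<open>auto simp: left[symmetric] simp del: pow_mat.simps index_mult_mat(1)\<close>)
  show "has_mat_derivative_within (\<lambda>u. mat_exp (u \<cdot>\<^sub>m M)) (mat_exp (t \<cdot>\<^sub>m M) * M) t S"
    using c has_real_derivative_mat_exp_entry[OF M, THEN has_field_derivative_at_within, of _ _ t S]
    by (subst has_mat_derivative_within_iff[of _ n n])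
      (use M c mult_carrier_mat[OF c M] in \<open>auto simp: right[symmetric] simp del: pow_mat.simps index_mult_mat(1)\<close>)
qed

section \<open>The Sylvester differential equation\<close>

text \<open>With \<open>h\<close> the primitive of \<open>\<sigma> \<mapsto> f (\<sigma> - t0)\<close>, the function \<open>\<tau> \<mapsto> - h (t + t0 - \<tau>)\<close> is a
  primitive of \<open>\<tau> \<mapsto> f (t - \<tau>)\<close> with the same increment. On the right-hand side \<open>t\<close> occurs
  only as a limit of integration, so that side can be differentiated in \<open>t\<close>.\<close>

lemma integral_reflect_interval:
  fixes f :: "real \<Rightarrow> real"
  assumes f: "continuous_on UNIV f" and t: "t0 \<le> t"
  shows "integral {t0..t} (\<lambda>\<tau>. f (t - \<tau>)) = integral {t0..t} (\<lambda>\<sigma>. f (\<sigma> - t0))"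
proof -
  define h where "h x = integral {t0..x} (\<lambda>\<sigma>. f (\<sigma> - t0))" for x
  have cont: "continuous_on {t0..t} (\<lambda>\<sigma>. f (\<sigma> - t0))"
    by (intro continuous_on_compose2[OF f] continuous_intros) auto
  have "((\<lambda>\<tau>. - h (t + t0 - \<tau>)) has_real_derivative f (t - x)) (at x within {t0..t})"
    if x: "x \<in> {t0..t}" for x
  proof -
    have "(h has_real_derivative f (t - x)) (at (t + t0 - x) within {t0..t})"
      using integral_has_real_derivative[OF cont, of "t + t0 - x"] x
      by (auto simp: h_def[abs_def])
    moreover have "(\<lambda>\<tau>. t + t0 - \<tau>) ` {t0..t} = {t0..t}"
    proof -
      have "y \<in> (\<lambda>\<tau>. t + t0 - \<tau>) ` {t0..t}" if "y \<in> {t0..t}" for y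
        using that by (intro image_eqI[of _ _ "t + t0 - y"]) auto
      thus ?thesis by auto
    qed
    ultimately have "(h \<circ> (\<lambda>\<tau>. t + t0 - \<tau>) has_real_derivative f (t - x) * -1)
        (at x within {t0..t})"
      by (intro DERIV_image_chain) (auto intro!: derivative_eq_intros)
    from DERIV_minus[OF this] show ?thesis by (simp add: o_def)
  qed
  hence "((\<lambda>\<tau>. f (t - \<tau>)) has_integral (- h (t + t0 - t) - - h (t + t0 - t0))) {t0..t}"
    using t by (intro fundamental_theorem_of_calculus)
      (auto simp: has_real_derivative_iff_has_vector_derivative)
  thus ?thesis by (simp add: h_def integral_unique)
qed

text \<open>After reflection the derivative of \<open>G\<close> at \<open>t\<close> is the integrand \<open>\<Phi> (t - t0)\<close>. Rewriting
  it as \<open>\<Phi> 0\<close> plus the integral of \<open>\<Phi>'\<close> expresses it through \<open>G t\<close> itself.\<close>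

lemma has_mat_derivative_sylvester_integral:
  fixes M N C :: "real mat"
  assumes M: "M \<in> carrier_mat n n" and N: "N \<in> carrier_mat k k" and C: "C \<in> carrier_mat n k"
    and G: "\<And>t. G t = mat_integral n k {t0..t}
        (\<lambda>\<tau>. mat_exp ((t - \<tau>) \<cdot>\<^sub>m M) * C * mat_exp ((t - \<tau>) \<cdot>\<^sub>m N))"
    and t: "t \<in> {t0..Tf}"
  shows "has_mat_derivative_within G (M * G t + G t * N + C) t {t0..Tf}"
proof -
  define \<Phi> where "\<Phi> u = mat_exp (u \<cdot>\<^sub>m M) * C * mat_exp (u \<cdot>\<^sub>m N)" for u
  have eM: "mat_exp (u \<cdot>\<^sub>m M) \<in> carrier_mat n n" and eN: "mat_exp (u \<cdot>\<^sub>m N) \<in> carrier_mat k k" for u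
    using M N by (auto intro: mat_exp_carrier)
  have \<Phi>c: "\<Phi> u \<in> carrier_mat n k" for u unfolding \<Phi>_def using eM eN C
    by (intro mult_carrier_mat[of _ _ k] mult_carrier_mat[of _ _ n]) auto
  have Gc: "G u \<in> carrier_mat n k" for u by (simp add: G mat_integral_def)
  have \<Phi>': "has_mat_derivative_within \<Phi> (M * \<Phi> u + \<Phi> u * N) u UNIV" for u
  proof -
    have "has_mat_derivative_within (\<lambda>u. mat_exp (u \<cdot>\<^sub>m M) * C * mat_exp (u \<cdot>\<^sub>m N))
        (M * mat_exp (u \<cdot>\<^sub>m M) * C * mat_exp (u \<cdot>\<^sub>m N)
          + mat_exp (u \<cdot>\<^sub>m M) * C * (mat_exp (u \<cdot>\<^sub>m N) * N)) u UNIV"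
      using M N C eM eN mult_carrier_mat[OF eN N]
      by (intro has_mat_derivative_within_mult[of _ _ _ _ _ _ n k k]
          has_mat_derivative_within_mult_right[of _ _ _ _ n n C k] has_mat_derivative_mat_exp) auto
    moreover have "M * mat_exp (u \<cdot>\<^sub>m M) * C * mat_exp (u \<cdot>\<^sub>m N) = M * \<Phi> u"
      using M C eM[of u] eN[of u]
      by (simp add: \<Phi>_def assoc_mult_mat[of _ n n _ n _ k] assoc_mult_mat[of _ n n _ k _ k])
    moreover have "mat_exp (u \<cdot>\<^sub>m M) * C * (mat_exp (u \<cdot>\<^sub>m N) * N) = \<Phi> u * N"
      unfolding \<Phi>_def using N C eM[of u] eN[of u] by (intro assoc_mult_mat[symmetric]) auto
    ultimately show ?thesis by (simp add: \<Phi>_def[abs_def])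
  qed
  have \<Phi>'_entry: "((\<lambda>u. \<Phi> u $$ (i, j)) has_real_derivative
      (\<Sum>l<n. M $$ (i, l) * \<Phi> u $$ (l, j)) + (\<Sum>l<k. \<Phi> u $$ (i, l) * N $$ (l, j))) (at u)"
    if ij: "i < n" "j < k" for i j u
  proof -
    have "(M * \<Phi> u + \<Phi> u * N) $$ (i, j) =
        (\<Sum>l<n. M $$ (i, l) * \<Phi> u $$ (l, j)) + (\<Sum>l<k. \<Phi> u $$ (i, l) * N $$ (l, j))"
      using M N \<Phi>c[of u] ij mat_mult_entry[OF M \<Phi>c ij] mat_mult_entry[OF \<Phi>c N ij]
      by (simp del: index_mult_mat(1))
    moreover have c: "M * \<Phi> u + \<Phi> u * N \<in> carrier_mat n k"
      using N \<Phi>c[of u] mult_carrier_mat[OF \<Phi>c N] by simp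
    moreover have "((\<lambda>u. \<Phi> u $$ (i, j)) has_real_derivative (M * \<Phi> u + \<Phi> u * N) $$ (i, j)) (at u)"
      using \<Phi>'[of u] ij unfolding has_mat_derivative_within_iff[OF c] by blast
    ultimately show ?thesis by simp
  qed
  have cont: "continuous_on S (\<lambda>u. \<Phi> u $$ (i, j))" if "i < n" "j < k" for i j S
    using \<Phi>'_entry[OF that] by (meson DERIV_isCont continuous_at_imp_continuous_on)
  have cont': "continuous_on S (\<lambda>u. \<Phi> (u - t0) $$ (i, j))" if "i < n" "j < k" for i j S
    by (rule continuous_on_compose2[OF cont[OF that, of UNIV]]) (auto intro!: continuous_intros)
  have G_entry: "G u $$ (i, j) = integral {t0..u} (\<lambda>\<sigma>. \<Phi> (\<sigma> - t0) $$ (i, j))"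
    if "u \<ge> t0" and ij: "i < n" "j < k" for u i j
    using integral_reflect_interval[OF cont[OF ij] that(1)] ij
    by (simp add: G mat_integral_def \<Phi>_def)
  have deriv: "((\<lambda>u. G u $$ (i, j)) has_real_derivative \<Phi> (t - t0) $$ (i, j))
      (at t within {t0..Tf})" if ij: "i < n" "j < k" for i j
    by (rule has_field_derivative_transform_within[where d = 1, OF
          integral_has_real_derivative[OF cont'[OF ij] t] _ t])
      (auto simp: G_entry ij)
  have value_at: "\<Phi> (t - t0) $$ (i, j) = (M * G t + G t * N + C) $$ (i, j)"
    if ij: "i < n" "j < k" for i j
  proof -
    have t': "t0 \<le> t" using t by simp
    have int: "(\<lambda>\<sigma>. \<Phi> (\<sigma> - t0) $$ (i, j)) integrable_on {t0..t}" if "i < n" "j < k" for i j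
      using cont'[OF that] by (rule integrable_continuous_real)
    have "((\<lambda>\<sigma>. \<Phi> (\<sigma> - t0) $$ (i, j)) has_real_derivative
        (\<Sum>l<n. M $$ (i, l) * \<Phi> (\<sigma> - t0) $$ (l, j)) + (\<Sum>l<k. \<Phi> (\<sigma> - t0) $$ (i, l) * N $$ (l, j)))
        (at \<sigma> within {t0..t})" for \<sigma>
    proof -
      have "((\<lambda>\<sigma>. \<sigma> - t0) has_real_derivative 1) (at \<sigma> within {t0..t})"
        by (auto intro!: derivative_eq_intros)
      from DERIV_chain2[where g = "\<lambda>\<sigma>. \<sigma> - t0", OF \<Phi>'_entry[OF ij, of "\<sigma> - t0"] this]
      show ?thesis by simp
    qed
    hence "((\<lambda>\<sigma>. (\<Sum>l<n. M $$ (i, l) * \<Phi> (\<sigma> - t0) $$ (l, j))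
          + (\<Sum>l<k. \<Phi> (\<sigma> - t0) $$ (i, l) * N $$ (l, j)))
        has_integral (\<Phi> (t - t0) $$ (i, j) - \<Phi> (t0 - t0) $$ (i, j))) {t0..t}"
      using t' by (intro fundamental_theorem_of_calculus)
        (auto simp: has_real_derivative_iff_has_vector_derivative)
    moreover have "((\<lambda>\<sigma>. (\<Sum>l<n. M $$ (i, l) * \<Phi> (\<sigma> - t0) $$ (l, j))
          + (\<Sum>l<k. \<Phi> (\<sigma> - t0) $$ (i, l) * N $$ (l, j)))
        has_integral ((\<Sum>l<n. M $$ (i, l) * G t $$ (l, j)) + (\<Sum>l<k. G t $$ (i, l) * N $$ (l, j))))
        {t0..t}"
      using ij t' by (intro has_integral_add has_integral_sum has_integral_mult_right
          has_integral_mult_left) (auto simp: G_entry intro!: integrable_integral int)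
    ultimately have "\<Phi> (t - t0) $$ (i, j) - \<Phi> (t0 - t0) $$ (i, j) =
        (\<Sum>l<n. M $$ (i, l) * G t $$ (l, j)) + (\<Sum>l<k. G t $$ (i, l) * N $$ (l, j))"
      by (rule has_integral_unique)
    hence "\<Phi> (t - t0) $$ (i, j) - \<Phi> 0 $$ (i, j) =
        (\<Sum>l<n. M $$ (i, l) * G t $$ (l, j)) + (\<Sum>l<k. G t $$ (i, l) * N $$ (l, j))"
      unfolding diff_self .
    moreover have "\<Phi> 0 = C"
      using C by (simp add: \<Phi>_def mat_exp_zero_smult[OF M] mat_exp_zero_smult[OF N])
    moreover have "(M * G t + G t * N + C) $$ (i, j) =
        (\<Sum>l<n. M $$ (i, l) * G t $$ (l, j)) + (\<Sum>l<k. G t $$ (i, l) * N $$ (l, j)) + C $$ (i, j)"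
      using M N C Gc[of t] ij mat_mult_entry[OF M Gc ij] mat_mult_entry[OF Gc N ij]
      by (simp del: index_mult_mat(1))
    ultimately show ?thesis by simp
  qed
  show ?thesis
    using deriv value_at Gc C by (subst has_mat_derivative_within_iff[of _ n k]) auto
qed

section \<open>The projected approximation\<close>

theorem proposition2p3:
  fixes A B E F :: "real mat" and n p s d m :: nat and t0 Tf :: real
    and kind :: arnoldi_kind
    and V W :: "nat \<Rightarrow> real mat"
    and calV calW TA TB TsubA TsubB Em Fm FmA FmB :: "real mat"
    and G X :: "real \<Rightarrow> real mat"
  assumes A: "A \<in> carrier_mat n n" and B: "B \<in> carrier_mat p p"
    and E: "E \<in> carrier_mat n s" "full_rank E"
    and F: "F \<in> carrier_mat p s" "full_rank F"
    and times: "t0 < Tf" and m: "m \<ge> 1"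
    and nonsingular: "kind = Extended \<Longrightarrow> invertible_mat A \<and> invertible_mat B"
    and d: "d = block_width kind s"
    and V: "arnoldi_blocks kind A E (m + 1) V"
    and W: "arnoldi_blocks kind (transpose_mat B) F (m + 1) W"
    and calV: "calV = collect_blocks n V m"
    and calW: "calW = collect_blocks p W m"
    and TA: "TA = transpose_mat calV * A * calV"
    and TB: "TB = transpose_mat calW * transpose_mat B * calW"
    and TsubA: "TsubA = transpose_mat (V (m + 1)) * A * V m"
    and TsubB: "TsubB = transpose_mat (W (m + 1)) * transpose_mat B * W m"
    and Em: "Em = transpose_mat calV * E"
    and Fm: "Fm = transpose_mat calW * F"
    and G: "\<And>t. G t = mat_integral (m * d) (m * d) {t0..t}
        (\<lambda>\<tau>. mat_exp ((t - \<tau>) \<cdot>\<^sub>m TA) * Em * transpose_mat Fm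
               * mat_exp ((t - \<tau>) \<cdot>\<^sub>m transpose_mat TB))"
    and X: "\<And>t. X t = calV * G t * transpose_mat calW"
    and FmA: "FmA = V (m + 1) * TsubA * transpose_mat (V m)"
    and FmB: "FmB = W m * transpose_mat TsubB * transpose_mat (W (m + 1))"
  shows "\<forall>t\<in>{t0..Tf}. has_mat_derivative_within X
    ((A - FmA) * X t + X t * (B - FmB) + E * transpose_mat F) t {t0..Tf}"
proof -
  have Bt: "transpose_mat B \<in> carrier_mat p p" using B by simp
  have inv_A: "invertible_mat A" if "kind = Extended" using nonsingular that by simp
  have inv_Bt: "invertible_mat (transpose_mat B)" if "kind = Extended"
    using nonsingular that B by (intro invertible_mat_transpose) auto
  note V = V[folded Suc_eq_plus1] and W = W[folded Suc_eq_plus1]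
  note arn_A = arnoldi_relation[OF A E(1) inv_A V m calV]
  note arn_B = arnoldi_relation[OF Bt F(1) inv_Bt W m calW]
  let ?q = "m * d"
  have Qc: "calV \<in> carrier_mat n ?q" and Vc: "V m \<in> carrier_mat n d" "V (m + 1) \<in> carrier_mat n d"
    using arnoldi_blocks_carrier[OF A E(1) V] m by (auto simp: d calV)
  have Rc: "calW \<in> carrier_mat p ?q" and Wc: "W m \<in> carrier_mat p d" "W (m + 1) \<in> carrier_mat p d"
    using arnoldi_blocks_carrier[OF Bt F(1) W] m by (auto simp: d calW)
  have TAc: "TA \<in> carrier_mat ?q ?q" and TBc: "TB \<in> carrier_mat ?q ?q"
    using A B Qc Rc by (auto simp: TA TB)
  have Emc: "Em \<in> carrier_mat ?q s" and Fmc: "Fm \<in> carrier_mat ?q s"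
    using E F Qc Rc by (auto simp: Em Fm)
  have Tsub: "TsubA \<in> carrier_mat d d" "TsubB \<in> carrier_mat d d"
    using A B Vc Wc by (auto simp: TsubA TsubB)
  have FmAc: "FmA \<in> carrier_mat n n" and FmBc: "FmB \<in> carrier_mat p p"
    using Vc Wc Tsub by (auto simp: FmA FmB)
  define C where "C = Em * transpose_mat Fm"
  have Cc: "C \<in> carrier_mat ?q ?q" using Emc Fmc by (simp add: C_def)
  have Gc: "G t \<in> carrier_mat ?q ?q" for t by (simp add: G mat_integral_def)

  have left: "(A - FmA) * calV = calV * TA"
    using arn_A(1) by (simp add: FmA TsubA TA)
  have FmB_t: "transpose_mat FmB = W (m + 1) * TsubB * transpose_mat (W m)"
  proof -
    have "transpose_mat FmB = W (m + 1) * transpose_mat (W m * transpose_mat TsubB)"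
      unfolding FmB using Wc Tsub by (subst transpose_mult[of _ p d _ p]) auto
    also have "transpose_mat (W m * transpose_mat TsubB) = TsubB * transpose_mat (W m)"
      using Wc Tsub by (subst transpose_mult[of _ p d _ d]) auto
    also have "W (m + 1) * \<dots> = W (m + 1) * TsubB * transpose_mat (W m)"
      using Wc Tsub by (intro assoc_mult_mat[symmetric]) auto
    finally show ?thesis .
  qed
  have right: "transpose_mat calW * (B - FmB) = transpose_mat TB * transpose_mat calW"
  proof -
    have "transpose_mat (transpose_mat calW * (B - FmB)) = transpose_mat (B - FmB) * calW"
      using FmBc Rc by (subst transpose_mult[of _ ?q p _ p]) (auto intro: minus_carrier_mat)
    also have "\<dots> = (transpose_mat B - transpose_mat FmB) * calW"
      unfolding transpose_minus[OF B FmBc] ..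
    also have "\<dots> = calW * TB"
      using arn_B(1) by (simp add: FmB_t TsubB TB)
    also have "\<dots> = transpose_mat (transpose_mat TB * transpose_mat calW)"
      using Rc TBc by (simp add: transpose_mult[of _ ?q ?q _ p])
    finally show ?thesis by simp
  qed
  have source: "calV * C * transpose_mat calW = E * transpose_mat F"
  proof -
    have "calV * C * transpose_mat calW = (calV * Em) * (transpose_mat Fm * transpose_mat calW)"
      using Qc Rc Emc Fmc
      by (simp add: C_def assoc_mult_mat[of _ n ?q _ ?q _ p] assoc_mult_mat[of _ ?q s _ ?q _ p]
          assoc_mult_mat[of _ n ?q _ s _ p])
    also have "transpose_mat Fm * transpose_mat calW = transpose_mat (calW * Fm)"
      using Rc Fmc by (simp add: transpose_mult[of _ p ?q _ s])
    finally show ?thesis using arn_A(2) arn_B(2) by (simp add: Em Fm)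
  qed

  show ?thesis
  proof
    fix t assume t: "t \<in> {t0..Tf}"
    have G': "has_mat_derivative_within G (TA * G t + G t * transpose_mat TB + C) t {t0..Tf}"
    proof (rule has_mat_derivative_sylvester_integral[OF TAc _ Cc _ t])
      show "transpose_mat TB \<in> carrier_mat ?q ?q" using TBc by simp
      have "mat_exp (u \<cdot>\<^sub>m TA) * Em * transpose_mat Fm = mat_exp (u \<cdot>\<^sub>m TA) * C" for u
        unfolding C_def using TAc Emc Fmc
        by (intro assoc_mult_mat[of _ ?q ?q _ s _ ?q] mat_exp_carrier) auto
      thus "G u = mat_integral ?q ?q {t0..u} (\<lambda>\<tau>. mat_exp ((u - \<tau>) \<cdot>\<^sub>m TA) * C *
          mat_exp ((u - \<tau>) \<cdot>\<^sub>m transpose_mat TB))" for u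
        by (simp add: G)
    qed
    have TBt: "transpose_mat TB \<in> carrier_mat ?q ?q" using TBc by simp
    have TG: "TA * G t \<in> carrier_mat ?q ?q" and GT: "G t * transpose_mat TB \<in> carrier_mat ?q ?q"
      using mult_carrier_mat[OF TAc Gc] mult_carrier_mat[OF Gc TBt] by auto
    have Rt: "transpose_mat calW \<in> carrier_mat ?q p" using Rc by simp
    have DGc: "TA * G t + G t * transpose_mat TB + C \<in> carrier_mat ?q ?q" using Cc by simp
    have VDc: "calV * (TA * G t + G t * transpose_mat TB + C) \<in> carrier_mat n ?q"
      using Qc DGc by simp
    have "has_mat_derivative_within (\<lambda>u. calV * G u * transpose_mat calW)
        (calV * (TA * G t + G t * transpose_mat TB + C) * transpose_mat calW) t {t0..Tf}"
      using has_mat_derivative_within_mult_left[OF G' Qc DGc t] VDc Rt t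
      by (rule has_mat_derivative_within_mult_right)
    moreover have "calV * (TA * G t + G t * transpose_mat TB + C) * transpose_mat calW =
        (A - FmA) * X t + X t * (B - FmB) + E * transpose_mat F"
    proof -
      note VTG = mult_carrier_mat[OF Qc TG] and VGT = mult_carrier_mat[OF Qc GT]
      have "calV * (TA * G t + G t * transpose_mat TB + C) =
          calV * (TA * G t) + calV * (G t * transpose_mat TB) + calV * C"
        unfolding mult_add_distrib_mat[OF Qc add_carrier_mat[OF GT] Cc]
          mult_add_distrib_mat[OF Qc TG GT] ..
      hence "calV * (TA * G t + G t * transpose_mat TB + C) * transpose_mat calW =
          calV * (TA * G t) * transpose_mat calW + calV * (G t * transpose_mat TB) * transpose_mat calW
          + calV * C * transpose_mat calW"
        using add_mult_distrib_mat[OF add_carrier_mat[OF VGT] mult_carrier_mat[OF Qc Cc] Rt]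
          add_mult_distrib_mat[OF VTG VGT Rt] by metis
      also have "calV * (TA * G t) * transpose_mat calW = calV * TA * (G t * transpose_mat calW)"
        using Qc Rt TAc Gc[of t]
        by (simp add: assoc_mult_mat[of _ n ?q _ ?q _ ?q] assoc_mult_mat[of _ n ?q _ ?q _ p]
            assoc_mult_mat[of _ ?q ?q _ ?q _ p])
      also have "\<dots> = (A - FmA) * X t"
        unfolding left[symmetric] X using minus_carrier_mat[OF FmAc, of A] Qc Rt Gc[of t]
        by (simp add: assoc_mult_mat[of _ n n _ ?q _ p] assoc_mult_mat[of _ n ?q _ ?q _ p])
      also have "calV * (G t * transpose_mat TB) * transpose_mat calW =
          calV * G t * (transpose_mat TB * transpose_mat calW)"
        using Qc Rt TBt Gc[of t]
        by (simp add: assoc_mult_mat[of _ n ?q _ ?q _ p] assoc_mult_mat[of _ ?q ?q _ ?q _ p])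
      also have "\<dots> = X t * (B - FmB)"
        unfolding right[symmetric] X
        by (rule assoc_mult_mat[symmetric, OF mult_carrier_mat[OF Qc Gc] Rt
              minus_carrier_mat[OF FmBc]])
      finally show ?thesis unfolding source .
    qed
    ultimately show "has_mat_derivative_within X
        ((A - FmA) * X t + X t * (B - FmB) + E * transpose_mat F) t {t0..Tf}"
      by (simp add: X[abs_def])
  qed
qed

end
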